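(* Let $n\ge 1$ be a fixed integer and let $t$ be an integer with $0\le t<n$. Let $p=p(D)\in[0,1]$ be such that $p=\omega(D^{-(t+1)})$ and $p=o(D^{-t})$ as $D\to\infty$, and let $\mathfrak I\sim\mathcal I(n,D,p(D))$. Then $\dim(S/\mathfrak I)=t$ asymptotically almost surely, i.e. $\lim_{D\to\infty}P(\dim(S/\mathfrak I)=t)=1$.
   Context: Let $k$ be a field and $S=k[x_1,\dots,x_n]$. $\mathcal B(n,D,p)$ is the distribution of the random set $\mathfrak B$ of monomials of $S$ obtained by including each non-constant monomial of total degree at most $D$ independently with probability $p$. $\mathcal I(n,D,p)$ is the distribution of the random monomial ideal $\mathfrak I=(\mathfrak B)$, with $\mathfrak I=(0)$ if $\mathfrak B=\emptyset$. $\dim$ denotes Krull dimension. $f=o(g)$, equivalently $g=\omega(f)$, means $\lim f/g=0$. *)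

theory Defs
  imports
    "HOL-Algebra.QuotRing"
    "HOL-Library.Poly_Mapping"
    "HOL-Library.Landau_Symbols"
    "HOL-Probability.Product_PMF"
begin

text \<open>
  A monomial is identified with its exponent vector, of type \<open>nat \<Rightarrow>\<^sub>0 nat\<close>.
  The polynomial ring in \<open>n\<close> variables consists of the polynomials over the
  countably many variables \<open>x\<^sub>0, x\<^sub>1, \<dots>\<close> in which only \<open>x\<^sub>0, \<dots>, x\<^bsub>n-1\<^esub>\<close> occur.
\<close>

definition poly_ring :: "nat \<Rightarrow> ((nat \<Rightarrow>\<^sub>0 nat) \<Rightarrow>\<^sub>0 'k :: field) ring" where
  "poly_ring n =
     \<lparr>carrier = {f. \<forall>m \<in> Poly_Mapping.keys f. Poly_Mapping.keys m \<subseteq> {..<n}},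
      monoid.mult = (*), one = 1, zero = 0, add = (+)\<rparr>"

definition total_degree :: "(nat \<Rightarrow>\<^sub>0 nat) \<Rightarrow> nat" where
  "total_degree m = (\<Sum>i \<in> Poly_Mapping.keys m. Poly_Mapping.lookup m i)"

definition monomials :: "nat \<Rightarrow> nat \<Rightarrow> (nat \<Rightarrow>\<^sub>0 nat) set" where
  "monomials n D = {m. Poly_Mapping.keys m \<subseteq> {..<n} \<and> m \<noteq> 0 \<and> total_degree m \<le> D}"

definition monomial_ideal :: "nat \<Rightarrow> (nat \<Rightarrow>\<^sub>0 nat) set \<Rightarrow> ((nat \<Rightarrow>\<^sub>0 nat) \<Rightarrow>\<^sub>0 'k :: field) set" where
  "monomial_ideal n B = Idl\<^bsub>poly_ring n\<^esub> ((\<lambda>m. Poly_Mapping.single m 1) ` B)"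

text \<open>
  The supremum is taken in the extended reals, so that the zero ring, which has no
  prime ideals, has dimension \<open>-\<infinity>\<close>. A strict chain \<open>P 0 \<subset> \<dots> \<subset> P l\<close> has length \<open>l\<close>.
\<close>

definition krull_dim :: "('a, 'b) ring_scheme \<Rightarrow> ereal" where
  "krull_dim R =
     Sup {ereal (real l) | l. \<exists>P. (\<forall>i\<le>l. primeideal (P i) R) \<and> (\<forall>i<l. P i \<subset> P (Suc i))}"

definition random_monomials :: "nat \<Rightarrow> nat \<Rightarrow> real \<Rightarrow> (nat \<Rightarrow>\<^sub>0 nat) set pmf" where
  "random_monomials n D p =
     map_pmf (\<lambda>b. {m. b m}) (Pi_pmf (monomials n D) False (\<lambda>_. bernoulli_pmf p))"

definition random_monomial_ideal ::
    "nat \<Rightarrow> nat \<Rightarrow> real \<Rightarrow> ((nat \<Rightarrow>\<^sub>0 nat) \<Rightarrow>\<^sub>0 'k :: field) set pmf" where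
  "random_monomial_ideal n D p = map_pmf (monomial_ideal n) (random_monomials n D p)"

text \<open>\<^const>\<open>Pi_pmf\<close> is meaningful only over a finite index set.\<close>

lemma finite_monomials: "finite (monomials n D)"
proof (rule finite_imageD)
  show "inj_on Poly_Mapping.lookup (monomials n D)"
    by (simp add: inj_on_def)
  have "Poly_Mapping.lookup m \<in> {f. \<forall>i. (i \<in> {..<n} \<longrightarrow> f i \<in> {..D}) \<and> (i \<notin> {..<n} \<longrightarrow> f i = 0)}"
    if "m \<in> monomials n D" for m
  proof -
    have k: "Poly_Mapping.keys m \<subseteq> {..<n}"
      and d: "(\<Sum>i \<in> Poly_Mapping.keys m. Poly_Mapping.lookup m i) \<le> D"
      using that by (auto simp: monomials_def total_degree_def)
    have "Poly_Mapping.lookup m i \<le> D" for i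
    proof (cases "i \<in> Poly_Mapping.keys m")
      case True
      then have "Poly_Mapping.lookup m i \<le> (\<Sum>i \<in> Poly_Mapping.keys m. Poly_Mapping.lookup m i)"
        by (intro member_le_sum) auto
      with d show ?thesis by simp
    qed (simp add: in_keys_iff)
    moreover have "Poly_Mapping.lookup m i = 0" if "i \<notin> {..<n}" for i
      using that k by (auto simp: in_keys_iff)
    ultimately show ?thesis by auto
  qed
  then have "Poly_Mapping.lookup ` monomials n D
      \<subseteq> {f. \<forall>i. (i \<in> {..<n} \<longrightarrow> f i \<in> {..D}) \<and> (i \<notin> {..<n} \<longrightarrow> f i = 0)}"
    by (rule image_subsetI)
  then show "finite (Poly_Mapping.lookup ` monomials n D)"
    by (rule finite_subset) (rule finite_set_of_finite_funs, rule finite_lessThan, rule finite_atMost)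
qed

lemma poly_ring_simps [simp]:
  "f \<otimes>\<^bsub>poly_ring n\<^esub> g = f * g" "f \<oplus>\<^bsub>poly_ring n\<^esub> g = f + g"
  "\<one>\<^bsub>poly_ring n\<^esub> = 1" "\<zero>\<^bsub>poly_ring n\<^esub> = 0"
  by (simp_all add: poly_ring_def)

lemma poly_ring_carrier_iff:
  "f \<in> carrier (poly_ring n) \<longleftrightarrow> (\<forall>m \<in> Poly_Mapping.keys f. Poly_Mapping.keys m \<subseteq> {..<n})"
  by (simp add: poly_ring_def)

lemma cring_poly_ring: "cring (poly_ring n :: ((nat \<Rightarrow>\<^sub>0 nat) \<Rightarrow>\<^sub>0 'k :: field) ring)"
proof -
  let ?R = "poly_ring n :: ((nat \<Rightarrow>\<^sub>0 nat) \<Rightarrow>\<^sub>0 'k) ring"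
  have zero: "0 \<in> carrier ?R" and one: "1 \<in> carrier ?R"
    by (simp_all add: poly_ring_carrier_iff)
  have minus: "- f \<in> carrier ?R" if "f \<in> carrier ?R" for f
    using that by (simp add: poly_ring_carrier_iff)
  have add: "f + g \<in> carrier ?R" if "f \<in> carrier ?R" "g \<in> carrier ?R" for f g
    using that Poly_Mapping.keys_add[of f g] unfolding poly_ring_carrier_iff by blast
  have mult: "f * g \<in> carrier ?R" if "f \<in> carrier ?R" "g \<in> carrier ?R" for f g
    unfolding poly_ring_carrier_iff
  proof
    fix m assume "m \<in> Poly_Mapping.keys (f * g)"
    then obtain a b where m: "m = a + b"
      and ab: "a \<in> Poly_Mapping.keys f" "b \<in> Poly_Mapping.keys g"
      using keys_mult[of f g] by blast
    have "Poly_Mapping.keys a \<union> Poly_Mapping.keys b \<subseteq> {..<n}"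
      using that ab by (meson poly_ring_carrier_iff Un_least)
    with Poly_Mapping.keys_add[of a b] show "Poly_Mapping.keys m \<subseteq> {..<n}"
      unfolding m by (rule subset_trans)
  qed
  show ?thesis
  proof (rule cringI)
    show "abelian_group ?R"
    proof (rule abelian_groupI)
      show "\<exists>g \<in> carrier ?R. g \<oplus>\<^bsub>?R\<^esub> f = \<zero>\<^bsub>?R\<^esub>" if "f \<in> carrier ?R" for f
        using minus[OF that] by (intro bexI[of _ "- f"]) simp_all
    qed (simp_all add: zero add ac_simps)
    show "comm_monoid ?R"
      by (rule comm_monoidI) (simp_all add: one mult ac_simps)
  qed (simp add: distrib_right)
qed

end

theory Submission
  imports Defs
begin

text \<open>
  The dimension of \<open>S / (B)\<close> for a set \<open>B\<close> of non-constant monomials is combinatorial: it is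
  the largest size of a set \<open>A\<close> of variables such that no element of \<open>B\<close> involves only
  variables in \<open>A\<close>. There are about \<open>D ^ s\<close> monomials of degree at most \<open>D\<close> in a given set
  of \<open>s\<close> variables, up to a constant factor. If \<open>p D * D ^ t\<close> tends to \<open>0\<close>, then with
  probability tending to one no monomial in the first \<open>t\<close> variables is chosen, so the
  dimension is at least \<open>t\<close>. If \<open>p D * D ^ (t + 1)\<close> tends to infinity, then with
  probability tending to one each of the finitely many sets of \<open>t + 1\<close> variables supports a
  chosen monomial, so the dimension is at most \<open>t\<close>. The quantitative form of this is
  \<open>prob_krull_dim_neq_le\<close>.

  The combinatorial description of the Krull dimension is
  \<open>krull_dim_monomial_quotient\<close>. Its lower bound needs only an explicit chain of coordinate
  primes. Its upper bound reduces to the statement that a chain of primes above a prime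
  \<open>P\<close> is no longer than the number of variables outside \<open>P\<close>
  (\<open>primeideal_chain_length\<close>). The proof of the latter avoids transcendence degrees: too
  many polynomials in few variables satisfy a polynomial relation
  (\<open>algebraically_dependent\<close>, by counting monomials), whereas elements witnessing the strict
  inclusions of a chain of primes cannot satisfy one (\<open>no_relation_along_chain\<close>).
\<close>

section \<open>Algebraic dependence of polynomials\<close>

text \<open>
  Gaussian elimination on a homogeneous system with the unknowns \<open>E\<close> and the equations
  \<open>K\<close>: each induction step eliminates an unknown \<open>e0\<close> with nonzero coefficient in the
  new equation, which leaves more unknowns than equations.
\<close>

lemma exists_linear_relation:
  fixes v :: "'e \<Rightarrow> 'a \<Rightarrow> 'k :: field"
  assumes "finite K" "finite E" "card K < card E"
  shows "\<exists>c. (\<exists>e\<in>E. c e \<noteq> 0) \<and> (\<forall>x\<in>K. (\<Sum>e\<in>E. c e * v e x) = 0)"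
  using assms
proof (induction K arbitrary: E v rule: finite_induct)
  case empty
  then have "E \<noteq> {}" by auto
  then show ?case by (intro exI[of _ "\<lambda>_. 1"]) auto
next
  case (insert k K)
  show ?case
  proof (cases "\<forall>e\<in>E. v e k = 0")
    case True
    have "card K < card E" using insert by simp
    from insert.IH[OF insert.prems(1) this, of v] True show ?thesis by auto
  next
    case False
    then obtain e0 where e0: "e0 \<in> E" "v e0 k \<noteq> 0" by blast
    define F where "F = E - {e0}"
    have F: "finite F" "card K < card F" "E = insert e0 F" "e0 \<notin> F"
      using insert e0 by (auto simp: F_def)
    obtain c where c: "\<exists>e\<in>F. c e \<noteq> 0"
      "\<And>x. x \<in> K \<Longrightarrow> (\<Sum>e\<in>F. c e * (v e x - v e k / v e0 k * v e0 x)) = 0"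
      using insert.IH[OF F(1,2), of "\<lambda>e x. v e x - v e k / v e0 k * v e0 x"] by blast
    \<comment> \<open>the value of the eliminated unknown, forced by the equation \<open>k\<close>\<close>
    define s where "s = - (\<Sum>e\<in>F. c e * v e k) / v e0 k"
    have "(\<Sum>e\<in>E. (c(e0 := s)) e * v e x) = 0" if "x \<in> insert k K" for x
    proof -
      have "(\<Sum>e\<in>E. (c(e0 := s)) e * v e x) = s * v e0 x + (\<Sum>e\<in>F. c e * v e x)"
        using F by (auto intro!: sum.cong)
      also have "\<dots> = (\<Sum>e\<in>F. c e * (v e x - v e k / v e0 k * v e0 x))"
        by (simp add: s_def right_diff_distrib sum_subtractf sum_distrib_right
            sum_divide_distrib mult.assoc)
      also have "\<dots> = 0"
        using that c(2) e0(2) by (cases "x = k") auto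
      finally show ?thesis .
    qed
    moreover have "\<exists>e\<in>E. (c(e0 := s)) e \<noteq> 0"
      using c(1) F by auto
    ultimately show ?thesis by blast
  qed
qed

definition polys_in :: "nat set \<Rightarrow> ((nat \<Rightarrow>\<^sub>0 nat) \<Rightarrow>\<^sub>0 'k :: field) set" where
  "polys_in A = {f. \<forall>m \<in> Poly_Mapping.keys f. Poly_Mapping.keys m \<subseteq> A}"

lemma carrier_poly_ring: "carrier (poly_ring n) = polys_in {..<n}"
  unfolding polys_in_def by (auto simp: poly_ring_def)

lemma polys_in_single [simp]: "Poly_Mapping.keys m \<subseteq> A \<Longrightarrow> Poly_Mapping.single m c \<in> polys_in A"
  by (auto simp: polys_in_def)

lemma polys_in_0 [simp]: "0 \<in> polys_in A" and polys_in_1 [simp]: "1 \<in> polys_in A"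
  by (auto simp: polys_in_def)

lemma polys_in_uminus: "f \<in> polys_in A \<Longrightarrow> - f \<in> polys_in A"
  by (simp add: polys_in_def)

lemma polys_in_add: "f \<in> polys_in A \<Longrightarrow> g \<in> polys_in A \<Longrightarrow> f + g \<in> polys_in A"
  using Poly_Mapping.keys_add[of f g] unfolding polys_in_def by blast

lemma polys_in_mult:
  assumes "f \<in> polys_in A" "g \<in> polys_in A"
  shows "f * g \<in> polys_in A"
  unfolding polys_in_def
proof (intro CollectI ballI)
  fix m assume "m \<in> Poly_Mapping.keys (f * g)"
  then obtain a b where "m = a + b" "a \<in> Poly_Mapping.keys f" "b \<in> Poly_Mapping.keys g"
    using keys_mult[of f g] by blast
  then show "Poly_Mapping.keys m \<subseteq> A"
    using assms Poly_Mapping.keys_add[of a b] unfolding polys_in_def by blast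
qed

lemma polys_in_sum: "(\<And>x. x \<in> X \<Longrightarrow> f x \<in> polys_in A) \<Longrightarrow> sum f X \<in> polys_in A"
  by (induction X rule: infinite_finite_induct) (auto intro: polys_in_add)

lemma polys_in_power: "f \<in> polys_in A \<Longrightarrow> f ^ k \<in> polys_in A"
  by (induction k) (auto intro: polys_in_mult)

definition power_product :: "'a :: comm_monoid_mult list \<Rightarrow> nat list \<Rightarrow> 'a" where
  "power_product ys e = prod_list (map2 (^) ys e)"

lemma power_product_simps [simp]:
  "power_product [] e = 1" "power_product (y # ys) (k # e) = y ^ k * power_product ys e"
  by (simp_all add: power_product_def)

lemma polys_in_power_product:
  "set ys \<subseteq> polys_in A \<Longrightarrow> power_product ys e \<in> polys_in A"
proof (induction ys arbitrary: e)
  case (Cons y ys)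
  then show ?case
    by (cases e) (auto simp: power_product_def intro!: polys_in_mult polys_in_power)
qed simp

definition box :: "nat set \<Rightarrow> nat \<Rightarrow> (nat \<Rightarrow>\<^sub>0 nat) set" where
  "box A d = {m. Poly_Mapping.keys m \<subseteq> A \<and> (\<forall>i. Poly_Mapping.lookup m i \<le> d)}"

text \<open>
  Boxes bound the degree in each variable separately rather than the total degree, so
  that they are products of intervals and can be counted exactly.
\<close>

lemma bij_betw_box:
  assumes "finite A"
  shows "bij_betw (\<lambda>m. restrict (Poly_Mapping.lookup m) A) (box A d) (A \<rightarrow>\<^sub>E {..d})"
proof (rule bij_betw_byWitness[where f' = "\<lambda>f. Abs_poly_mapping (\<lambda>i. if i \<in> A then f i else 0)"])
  have lookup: "Poly_Mapping.lookup (Abs_poly_mapping (\<lambda>i. if i \<in> A then f i else 0)) i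
      = (if i \<in> A then f i else 0)" for f :: "nat \<Rightarrow> nat" and i
    by (subst lookup_Abs_poly_mapping) (auto intro: finite_subset[OF _ assms])
  show "\<forall>m\<in>box A d. Abs_poly_mapping (\<lambda>i. if i \<in> A then restrict (Poly_Mapping.lookup m) A i else 0) = m"
  proof
    fix m assume "m \<in> box A d"
    then have "(\<lambda>i. if i \<in> A then restrict (Poly_Mapping.lookup m) A i else 0) = Poly_Mapping.lookup m"
      by (auto simp: box_def fun_eq_iff in_keys_iff)
    then show "Abs_poly_mapping (\<lambda>i. if i \<in> A then restrict (Poly_Mapping.lookup m) A i else 0) = m"
      by simp
  qed
  show "\<forall>f\<in>A \<rightarrow>\<^sub>E {..d}. restrict (Poly_Mapping.lookup (Abs_poly_mapping (\<lambda>i. if i \<in> A then f i else 0))) A = f"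
    by (auto simp: lookup fun_eq_iff PiE_def extensional_def)
  show "(\<lambda>m. restrict (Poly_Mapping.lookup m) A) ` box A d \<subseteq> A \<rightarrow>\<^sub>E {..d}"
    by (auto simp: box_def)
  show "(\<lambda>f. Abs_poly_mapping (\<lambda>i. if i \<in> A then f i else 0)) ` (A \<rightarrow>\<^sub>E {..d}) \<subseteq> box A d"
    by (auto simp: box_def lookup in_keys_iff split: if_splits)
qed

lemma card_box: "finite A \<Longrightarrow> card (box A d) = (d + 1) ^ card A"
  using bij_betw_same_card[OF bij_betw_box, of A d] by (simp add: card_PiE)

lemma finite_box: "finite A \<Longrightarrow> finite (box A d)"
  using bij_betw_finite[OF bij_betw_box, of A d] by (simp add: finite_PiE)

lemma keys_mult_box:
  assumes "Poly_Mapping.keys f \<subseteq> box A d" "Poly_Mapping.keys g \<subseteq> box A d'"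
  shows "Poly_Mapping.keys (f * g) \<subseteq> box A (d + d')"
proof
  fix m assume "m \<in> Poly_Mapping.keys (f * g)"
  then obtain a b where m: "m = a + b" "a \<in> Poly_Mapping.keys f" "b \<in> Poly_Mapping.keys g"
    using keys_mult[of f g] by blast
  then have "a \<in> box A d" "b \<in> box A d'" using assms by auto
  then show "m \<in> box A (d + d')"
    using Poly_Mapping.keys_add[of a b] by (auto simp: m(1) box_def lookup_add add_mono)
qed

lemma keys_power_box:
  assumes "Poly_Mapping.keys (f :: (nat \<Rightarrow>\<^sub>0 nat) \<Rightarrow>\<^sub>0 'k :: field) \<subseteq> box A d"
  shows "Poly_Mapping.keys (f ^ k) \<subseteq> box A (d * k)"
proof (induction k)
  case 0
  then show ?case by (auto simp: box_def)
next
  case (Suc k)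
  show ?case using keys_mult_box[OF assms Suc] by simp
qed

lemma keys_power_product_box:
  assumes "\<And>y. y \<in> set ys \<Longrightarrow> Poly_Mapping.keys (y :: (nat \<Rightarrow>\<^sub>0 nat) \<Rightarrow>\<^sub>0 'k :: field) \<subseteq> box A d"
    and "length e = length ys"
  shows "Poly_Mapping.keys (power_product ys e) \<subseteq> box A (d * sum_list e)"
  using assms(2,1)
proof (induction e ys rule: list_induct2)
  case Nil
  then show ?case by (auto simp: box_def)
next
  case (Cons k e y ys)
  have "Poly_Mapping.keys (y ^ k) \<subseteq> box A (d * k)"
    by (rule keys_power_box) (simp add: Cons.prems)
  from keys_mult_box[OF this Cons.IH] Cons.prems show ?case by (simp add: distrib_left)
qed

lemma polys_in_box:
  assumes "finite (Y :: ((nat \<Rightarrow>\<^sub>0 nat) \<Rightarrow>\<^sub>0 'k :: field) set)" "Y \<subseteq> polys_in A"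
  shows "\<exists>d. \<forall>y\<in>Y. Poly_Mapping.keys y \<subseteq> box A d"
proof -
  define V where "V = (\<Union>y\<in>Y. \<Union>m\<in>Poly_Mapping.keys y. Poly_Mapping.lookup m ` Poly_Mapping.keys m)"
  have "finite V" using assms by (auto simp: V_def)
  have "Poly_Mapping.lookup m i \<le> Max (insert 0 V)" if "y \<in> Y" "m \<in> Poly_Mapping.keys y" for y m i
  proof (cases "i \<in> Poly_Mapping.keys m")
    case True
    with that have "Poly_Mapping.lookup m i \<in> V" by (auto simp: V_def)
    then show ?thesis using \<open>finite V\<close> by (intro Max_ge) auto
  qed (simp add: in_keys_iff)
  moreover have "Poly_Mapping.keys m \<subseteq> A" if "y \<in> Y" "m \<in> Poly_Mapping.keys y" for y m
    using that assms(2) unfolding polys_in_def by blast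
  ultimately show ?thesis
    unfolding box_def by (intro exI[of _ "Max (insert 0 V)"] ballI subsetI CollectI conjI allI) blast+
qed

text \<open>
  Counting monomials: \<open>r\<close> polynomials have \<open>N ^ r\<close> power products with exponents below
  \<open>N\<close>, and for \<open>r > card A\<close> there is no room for all of them to be independent. Their
  degree in each variable is \<open>O(N)\<close>, so they lie in a space of dimension
  \<open>O(N ^ card A)\<close>, and a linear relation between them exists once \<open>N\<close> is large.
  Restricting it to its nonzero coefficients leaves a nonempty set \<open>E\<close> of exponents.
\<close>

lemma algebraically_dependent:
  fixes ys :: "((nat \<Rightarrow>\<^sub>0 nat) \<Rightarrow>\<^sub>0 'k :: field) list"
  assumes "finite A" "set ys \<subseteq> polys_in A" "card A < length ys"
  obtains E c where "finite E" "E \<noteq> {}" "\<And>e. e \<in> E \<Longrightarrow> length e = length ys \<and> c e \<noteq> 0"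
    "(\<Sum>e\<in>E. Poly_Mapping.single 0 (c e) * power_product ys e) = 0"
proof -
  let ?r = "length ys" and ?a = "card A"
  obtain d where d: "\<And>y. y \<in> set ys \<Longrightarrow> Poly_Mapping.keys y \<subseteq> box A d"
    using polys_in_box[of "set ys" A] assms(2) by auto
  define M where "M = d * ?r + 1"
  \<comment> \<open>\<open>N > M ^ card A\<close> makes \<open>(M * N) ^ card A < N ^ (card A + 1)\<close>\<close>
  define N where "N = M ^ ?a + 1"
  define L where "L = {e. set e \<subseteq> {..<N} \<and> length e = ?r}"
  let ?K = "box A (d * (?r * N))"
  have finL: "finite L" and cardL: "card L = N ^ ?r"
    by (simp_all add: L_def finite_lists_length_eq card_lists_length_eq)
  have keysL: "Poly_Mapping.keys (power_product ys e) \<subseteq> ?K" if "e \<in> L" for e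
  proof -
    have "sum_list e \<le> ?r * N"
      using that sum_list_mono[of e "\<lambda>x::nat. x" "\<lambda>_. N"]
      by (force simp: L_def sum_list_triv)
    then have "box A (d * sum_list e) \<subseteq> ?K"
      by (auto simp: box_def intro: order_trans mult_le_mono2)
    then show ?thesis using keys_power_product_box[of ys A d e] d that by (auto simp: L_def)
  qed
  have "card ?K \<le> (M * N) ^ ?a"
    unfolding card_box[OF assms(1)]
    by (rule power_mono) (auto simp: M_def N_def algebra_simps)
  also have "\<dots> < N ^ (?a + 1)"
    by (simp add: power_mult_distrib) (simp add: N_def)
  also have "\<dots> \<le> N ^ ?r"
    using assms(3) by (intro power_increasing) (auto simp: N_def)
  finally have "card ?K < card L" by (simp add: cardL)
  from exists_linear_relation[OF finite_box[OF assms(1)] finL this,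
      of "\<lambda>e. Poly_Mapping.lookup (power_product ys e)"]
  obtain c where c: "\<exists>e\<in>L. c e \<noteq> 0"
    "\<And>x. x \<in> ?K \<Longrightarrow> (\<Sum>e\<in>L. c e * Poly_Mapping.lookup (power_product ys e) x) = 0"
    by blast
  have lk: "Poly_Mapping.lookup (Poly_Mapping.single 0 a * f) x = a * Poly_Mapping.lookup f x"
    for a x and f :: "(nat \<Rightarrow>\<^sub>0 nat) \<Rightarrow>\<^sub>0 'k"
    by (simp flip: mult_map_scale_conv_mult add: Poly_Mapping.map.rep_eq when_def)
  have "(\<Sum>e\<in>L. Poly_Mapping.single 0 (c e) * power_product ys e) = 0"
  proof (rule poly_mapping_eqI)
    fix x
    show "Poly_Mapping.lookup (\<Sum>e\<in>L. Poly_Mapping.single 0 (c e) * power_product ys e) x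
        = Poly_Mapping.lookup 0 x"
    proof (cases "x \<in> ?K")
      case True
      then show ?thesis using c(2) by (simp add: lookup_sum lk)
    next
      case False
      then have "Poly_Mapping.lookup (power_product ys e) x = 0" if "e \<in> L" for e
        using keysL[OF that] by (auto simp: in_keys_iff)
      then show ?thesis by (simp add: lookup_sum lk)
    qed
  qed
  moreover have "(\<Sum>e\<in>{e\<in>L. c e \<noteq> 0}. Poly_Mapping.single 0 (c e) * power_product ys e)
      = (\<Sum>e\<in>L. Poly_Mapping.single 0 (c e) * power_product ys e)"
    by (rule sum.mono_neutral_left) (use finL in auto)
  moreover have "finite {e\<in>L. c e \<noteq> 0}" using finL by simp
  moreover have "{e\<in>L. c e \<noteq> 0} \<noteq> {}" using c(1) by blast
  moreover have "length e = ?r \<and> c e \<noteq> 0" if "e \<in> {e\<in>L. c e \<noteq> 0}" for e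
    using that by (simp add: L_def)
  ultimately show thesis using that[of "{e\<in>L. c e \<noteq> 0}" c] by metis
qed


section \<open>Chains of prime ideals in the polynomial ring\<close>

lemma primeideal_add:
  "primeideal P (poly_ring n) \<Longrightarrow> f \<in> P \<Longrightarrow> g \<in> P \<Longrightarrow> f + g \<in> P"
  using additive_subgroup.a_closed[of P "poly_ring n" f g]
  by (simp add: primeideal_def ideal_def)

lemma primeideal_mult:
  "primeideal P (poly_ring n) \<Longrightarrow> f \<in> polys_in {..<n} \<Longrightarrow> g \<in> P \<Longrightarrow> f * g \<in> P"
  using ideal.I_l_closed[of P "poly_ring n" g f]
  by (simp add: primeideal_def carrier_poly_ring)

lemma primeideal_zero: "primeideal P (poly_ring n) \<Longrightarrow> 0 \<in> P"
  using additive_subgroup.zero_closed[of P "poly_ring n"]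
  by (simp add: primeideal_def ideal_def)

lemma primeideal_subset: "primeideal P (poly_ring n) \<Longrightarrow> P \<subseteq> polys_in {..<n}"
  using additive_subgroup.a_subset[of P "poly_ring n"]
  by (simp add: primeideal_def ideal_def carrier_poly_ring)

lemma primeideal_diff:
  assumes "primeideal P (poly_ring n)" "f \<in> P" "g \<in> P"
  shows "f - g \<in> P"
proof -
  have "(- 1) * g \<in> P" by (intro primeideal_mult[OF assms(1) _ assms(3)] polys_in_uminus polys_in_1)
  then show ?thesis using primeideal_add[OF assms(1,2), of "- g"] by simp
qed

lemma primeideal_sum:
  "primeideal P (poly_ring n) \<Longrightarrow> (\<And>x. x \<in> X \<Longrightarrow> f x \<in> P) \<Longrightarrow> sum f X \<in> P"
  by (induction X rule: infinite_finite_induct) (auto intro: primeideal_add primeideal_zero)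

lemma primeideal_unit:
  assumes "primeideal P (poly_ring n)" "c \<noteq> 0"
  shows "Poly_Mapping.single 0 c \<notin> P"
proof
  assume "Poly_Mapping.single 0 c \<in> P"
  then have "Poly_Mapping.single 0 (1 / c) * Poly_Mapping.single 0 c \<in> P"
    by (intro primeideal_mult[OF assms(1)]) auto
  then have "1 \<in> P" using assms(2) by (simp add: mult_single)
  then show False
    using ideal.one_imp_carrier[of P "poly_ring n"] assms(1) primeideal.I_notcarr[of P "poly_ring n"]
    by (simp add: primeideal_def)
qed

lemma primeideal_prime:
  "primeideal P (poly_ring n) \<Longrightarrow> f * g \<in> P \<Longrightarrow> f \<in> polys_in {..<n} \<Longrightarrow> g \<in> polys_in {..<n}
    \<Longrightarrow> f \<in> P \<or> g \<in> P"
  using primeideal.I_prime[of P "poly_ring n" f g] by (simp add: carrier_poly_ring)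

lemma primeideal_power_cancel:
  assumes "primeideal P (poly_ring n)" "y ^ k * f \<in> P" "y \<in> polys_in {..<n}" "f \<in> polys_in {..<n}" "y \<notin> P"
  shows "f \<in> P"
  using assms(2)
proof (induction k)
  case (Suc k)
  then have "y * (y ^ k * f) \<in> P" by (simp add: mult.assoc)
  then show ?case
    using primeideal_prime[OF assms(1)] assms(3-5) Suc.IH by (meson polys_in_mult polys_in_power)
qed simp

text \<open>
  The argument goes back to Coquand and Lombardi. Write \<open>y\<^sub>0, \<dots>, y\<^bsub>r-1\<^esub>\<close> for the entries
  of \<open>ys\<close>, which enter the chain one after the other, and suppose that they satisfy a
  polynomial relation over the field modulo \<open>P 0\<close>. Let \<open>k\<close> be the least exponent of
  \<open>y\<^sub>0\<close> in it. As \<open>y\<^sub>0\<close> is not in the prime ideal \<open>P 0\<close>, the factor \<open>y\<^sub>0 ^ k\<close> can be cancelled. In \<open>P 1\<close>, which contains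
  \<open>y\<^sub>0\<close>, the terms that still contain \<open>y\<^sub>0\<close> can be dropped. What remains is a nontrivial
  relation between \<open>y\<^sub>1, \<dots>, y\<^bsub>r-1\<^esub>\<close> modulo \<open>P 1\<close>. After the last step a nonzero
  constant lies in a prime ideal, which is impossible.
\<close>

lemma no_relation_along_chain:
  fixes P :: "nat \<Rightarrow> ((nat \<Rightarrow>\<^sub>0 nat) \<Rightarrow>\<^sub>0 'k :: field) set"
  assumes "\<And>i. i \<le> length ys \<Longrightarrow> primeideal (P i) (poly_ring n)"
    and "\<And>i. i < length ys \<Longrightarrow> P i \<subseteq> P (Suc i) \<and> ys ! i \<in> P (Suc i) - P i"
    and "finite E" "E \<noteq> {}" "\<And>e. e \<in> E \<Longrightarrow> length e = length ys \<and> c e \<noteq> 0"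
  shows "(\<Sum>e\<in>E. Poly_Mapping.single 0 (c e) * power_product ys e) \<notin> P 0"
  using assms
proof (induction ys arbitrary: P E c)
  case Nil
  then have "E = {[]}" by auto
  then show ?case using Nil.prems primeideal_unit[of "P 0" n "c []"] by auto
next
  case (Cons y ys)
  note prime = Cons.prems(1) and chain = Cons.prems(2)
  let ?S = "polys_in {..<n} :: ((nat \<Rightarrow>\<^sub>0 nat) \<Rightarrow>\<^sub>0 'k) set"
  define k where "k = Min (hd ` E)"
  have kmin: "k \<le> hd e" if "e \<in> E" for e
    using that Cons.prems(3) by (simp add: k_def)
  have "k \<in> hd ` E" using Cons.prems(3,4) by (simp add: k_def)
  \<comment> \<open>\<open>E0\<close>: tails of the exponents with the least power of \<open>y\<close>; \<open>E1\<close>: the other exponents\<close>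
  define E0 where "E0 = {e. k # e \<in> E}"
  define E1 where "E1 = {e \<in> E. k < hd e}"
  have E0E: "(#) k ` E0 = {e \<in> E. hd e = k}"
    using Cons.prems(5) by (force simp: E0_def image_iff length_Suc_conv)
  have EE: "E = (#) k ` E0 \<union> E1" "(#) k ` E0 \<inter> E1 = {}"
    unfolding E0E E1_def using kmin by force+
  have fin: "finite E0" "finite ((#) k ` E0)" "finite E1"
    using Cons.prems(3) E0E by (auto simp: E1_def E0_def intro: finite_imageD[of "(#) k"])
  have "E0 \<noteq> {}" using \<open>k \<in> hd ` E\<close> E0E by blast
  define F0 where "F0 = (\<Sum>e\<in>E0. Poly_Mapping.single 0 (c (k # e)) * power_product ys e)"
  define F1 where "F1 = (\<Sum>e\<in>E1. Poly_Mapping.single 0 (c e) *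
      (y ^ (hd e - Suc k) * power_product ys (tl e)))"
  have ysS: "set (y # ys) \<subseteq> ?S"
  proof
    fix z assume "z \<in> set (y # ys)"
    then obtain i where "i < length (y # ys)" "z = (y # ys) ! i" by (metis in_set_conv_nth)
    then show "z \<in> ?S" using chain[of i] primeideal_subset[OF prime[of "Suc i"]] by auto
  qed
  have F0S: "F0 \<in> ?S" and F1S: "F1 \<in> ?S"
    unfolding F0_def F1_def using ysS
    by (auto intro!: polys_in_sum polys_in_mult polys_in_power polys_in_power_product)
  have "(\<Sum>e\<in>E. Poly_Mapping.single 0 (c e) * power_product (y # ys) e)
      = (\<Sum>e\<in>E0. Poly_Mapping.single 0 (c (k # e)) * power_product (y # ys) (k # e))
        + (\<Sum>e\<in>E1. Poly_Mapping.single 0 (c e) * power_product (y # ys) e)"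
    by (subst EE(1), subst sum.union_disjoint[OF fin(2,3) EE(2)], subst sum.reindex) auto
  also have "(\<Sum>e\<in>E0. Poly_Mapping.single 0 (c (k # e)) * power_product (y # ys) (k # e)) = y ^ k * F0"
    by (simp add: F0_def sum_distrib_left mult_ac)
  also have "(\<Sum>e\<in>E1. Poly_Mapping.single 0 (c e) * power_product (y # ys) e) = y ^ Suc k * F1"
    unfolding F1_def sum_distrib_left
  proof (rule sum.cong)
    fix e assume "e \<in> E1"
    then obtain a e' where e: "e = a # e'" "k < a"
      using Cons.prems(5) by (cases e) (force simp: E1_def)+
    then have "y ^ a = y ^ Suc k * y ^ (a - Suc k)"
      by (simp del: power_Suc flip: power_add)
    then show "Poly_Mapping.single 0 (c e) * power_product (y # ys) e
        = y ^ Suc k * (Poly_Mapping.single 0 (c e) * (y ^ (hd e - Suc k) * power_product ys (tl e)))"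
      by (simp add: e mult_ac)
  qed simp
  finally have eq: "(\<Sum>e\<in>E. Poly_Mapping.single 0 (c e) * power_product (y # ys) e)
      = y ^ k * (F0 + y * F1)"
    by (simp add: algebra_simps)
  show ?case
  proof
    assume "(\<Sum>e\<in>E. Poly_Mapping.single 0 (c e) * power_product (y # ys) e) \<in> P 0"
    then have "F0 + y * F1 \<in> P 0"
      unfolding eq using prime[of 0] chain[of 0] ysS F0S F1S
      by (intro primeideal_power_cancel[of "P 0" n y k "F0 + y * F1"]) (auto intro: polys_in_add polys_in_mult)
    then have "F0 + y * F1 \<in> P 1" using chain[of 0] by auto
    moreover have "F1 * y \<in> P 1"
      using chain[of 0] prime[of 1] F1S by (intro primeideal_mult) auto
    ultimately have "F0 + y * F1 - F1 * y \<in> P 1"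
      by (intro primeideal_diff) (use prime[of 1] in auto)
    then have "F0 \<in> P (Suc 0)" by (simp add: mult.commute)
    moreover have "F0 \<notin> P (Suc 0)"
      unfolding F0_def
    proof (rule Cons.IH[of "\<lambda>i. P (Suc i)"])
      show "\<And>i. i \<le> length ys \<Longrightarrow> primeideal (P (Suc i)) (poly_ring n)" using prime by simp
      show "\<And>i. i < length ys \<Longrightarrow> P (Suc i) \<subseteq> P (Suc (Suc i)) \<and> ys ! i \<in> P (Suc (Suc i)) - P (Suc i)"
        using chain[of "Suc _"] by simp
      show "finite E0" "E0 \<noteq> {}" by fact+
      show "\<And>e. e \<in> E0 \<Longrightarrow> length e = length ys \<and> c (k # e) \<noteq> 0"
        using Cons.prems(5) by (force simp: E0_def)
    qed
    ultimately show False by simp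
  qed
qed

definition restrict_vars :: "nat set \<Rightarrow> ((nat \<Rightarrow>\<^sub>0 nat) \<Rightarrow>\<^sub>0 'k :: field) \<Rightarrow> ((nat \<Rightarrow>\<^sub>0 nat) \<Rightarrow>\<^sub>0 'k)" where
  "restrict_vars A f =
     (\<Sum>m | m \<in> Poly_Mapping.keys f \<and> Poly_Mapping.keys m \<subseteq> A. Poly_Mapping.single m (Poly_Mapping.lookup f m))"

lemma restrict_vars_in: "restrict_vars A f \<in> polys_in A"
  unfolding restrict_vars_def by (rule polys_in_sum) auto

lemma sum_monomials:
  "(\<Sum>m\<in>Poly_Mapping.keys f. Poly_Mapping.single m (Poly_Mapping.lookup f m)) = f"
  by (rule poly_mapping_eqI) (auto simp: lookup_sum lookup_single when_def in_keys_iff)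

lemma diff_restrict_vars:
  "f - restrict_vars A f =
     (\<Sum>m | m \<in> Poly_Mapping.keys f \<and> \<not> Poly_Mapping.keys m \<subseteq> A. Poly_Mapping.single m (Poly_Mapping.lookup f m))"
proof -
  let ?g = "\<lambda>m. Poly_Mapping.single m (Poly_Mapping.lookup f m)"
  have "sum ?g (Poly_Mapping.keys f) = sum ?g {m \<in> Poly_Mapping.keys f. Poly_Mapping.keys m \<subseteq> A}
      + sum ?g {m \<in> Poly_Mapping.keys f. \<not> Poly_Mapping.keys m \<subseteq> A}"
    by (subst sum.union_disjoint[symmetric]) (auto intro!: sum.cong)
  then show ?thesis
    unfolding sum_monomials restrict_vars_def by (simp only: diff_eq_eq add.commute)
qed

text \<open>
  The ideal generated by the variables outside \<open>A\<close>, that is, the vanishing ideal of the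
  coordinate subspace with directions \<open>A\<close>. Describing it by the monomials that occur
  makes membership immediate to check.
\<close>

definition coord_prime :: "nat \<Rightarrow> nat set \<Rightarrow> ((nat \<Rightarrow>\<^sub>0 nat) \<Rightarrow>\<^sub>0 'k :: field) set" where
  "coord_prime n A = {f \<in> polys_in {..<n}. \<forall>m\<in>Poly_Mapping.keys f. \<not> Poly_Mapping.keys m \<subseteq> A}"

lemma keys_add_nat: "Poly_Mapping.keys (a + b) = Poly_Mapping.keys a \<union> Poly_Mapping.keys (b :: nat \<Rightarrow>\<^sub>0 nat)"
  by (auto simp: in_keys_iff lookup_add)

text \<open>
  Primality comes from the absence of zero divisors among polynomials: modulo the ideal,
  \<open>f\<close> and \<open>g\<close> agree with their restrictions to \<open>A\<close>, whose product again involves only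
  variables in \<open>A\<close> and lies in the ideal only if it vanishes.
\<close>

lemma primeideal_coord_prime:
  "primeideal (coord_prime n A) (poly_ring n :: ((nat \<Rightarrow>\<^sub>0 nat) \<Rightarrow>\<^sub>0 'k :: field) ring)"
proof (rule primeidealI[OF _ cring_poly_ring])
  let ?R = "poly_ring n :: ((nat \<Rightarrow>\<^sub>0 nat) \<Rightarrow>\<^sub>0 'k :: field) ring"
  let ?P = "coord_prime n A :: ((nat \<Rightarrow>\<^sub>0 nat) \<Rightarrow>\<^sub>0 'k :: field) set"
  interpret cring ?R by (rule cring_poly_ring)
  have add: "f + g \<in> ?P" if "f \<in> ?P" "g \<in> ?P" for f g
    using that Poly_Mapping.keys_add[of f g] polys_in_add[of f _ g] unfolding coord_prime_def by blast
  have sum: "sum F X \<in> ?P" if "\<And>x. x \<in> X \<Longrightarrow> F x \<in> ?P" for F and X :: "(nat \<Rightarrow>\<^sub>0 nat) set"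
    using that by (induction X rule: infinite_finite_induct) (simp_all add: add, simp_all add: coord_prime_def)
  have minus: "- f \<in> ?P" if "f \<in> ?P" for f
    using that polys_in_uminus by (auto simp: coord_prime_def)
  have mult: "f * g \<in> ?P" if "f \<in> polys_in {..<n}" "g \<in> ?P" for f g
  proof -
    have "\<not> Poly_Mapping.keys m \<subseteq> A" if "m \<in> Poly_Mapping.keys (f * g)" for m
    proof -
      from that obtain a b where "m = a + b" "b \<in> Poly_Mapping.keys g"
        using keys_mult[of f g] by blast
      with \<open>g \<in> ?P\<close> show ?thesis by (auto simp: coord_prime_def keys_add_nat)
    qed
    with that show ?thesis using polys_in_mult[of f _ g] by (simp add: coord_prime_def)
  qed
  show "ideal ?P ?R"
  proof (rule idealI)
    show "ring ?R" by (rule ring_axioms)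
    show "subgroup ?P (add_monoid ?R)"
    proof (rule add.subgroupI)
      show "?P \<subseteq> carrier ?R" by (auto simp: coord_prime_def carrier_poly_ring)
      show "?P \<noteq> {}" by (auto simp: coord_prime_def intro!: exI[of _ 0])
      fix f assume f: "f \<in> ?P"
      have "\<ominus>\<^bsub>?R\<^esub> f = - f"
        using f minus[OF f] by (intro minus_equality) (auto simp: coord_prime_def carrier_poly_ring)
      then show "\<ominus>\<^bsub>?R\<^esub> f \<in> ?P" using minus[OF f] by simp
    qed (simp add: add)
    fix f g assume fg: "f \<in> ?P" "g \<in> carrier ?R"
    then show "g \<otimes>\<^bsub>?R\<^esub> f \<in> ?P" by (simp add: carrier_poly_ring mult)
    then show "f \<otimes>\<^bsub>?R\<^esub> g \<in> ?P" by (simp add: mult.commute)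
  qed
  show "carrier ?R \<noteq> ?P"
  proof -
    have "1 \<in> carrier ?R" by (simp add: carrier_poly_ring)
    moreover have "1 \<notin> ?P" by (simp add: coord_prime_def)
    ultimately show ?thesis by blast
  qed
  fix f g assume fg: "f \<in> carrier ?R" "g \<in> carrier ?R" "f \<otimes>\<^bsub>?R\<^esub> g \<in> ?P"
  have res: "h - restrict_vars A h \<in> ?P" "restrict_vars A h \<in> polys_in {..<n}"
    if "h \<in> polys_in {..<n}" for h :: "(nat \<Rightarrow>\<^sub>0 nat) \<Rightarrow>\<^sub>0 'k"
  proof -
    show *: "restrict_vars A h \<in> polys_in {..<n}"
      using that unfolding restrict_vars_def
      by (intro polys_in_sum polys_in_single) (unfold polys_in_def, blast)
    show "h - restrict_vars A h \<in> ?P"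
      unfolding diff_restrict_vars
    proof (rule sum)
      fix m assume "m \<in> {m. m \<in> Poly_Mapping.keys h \<and> \<not> Poly_Mapping.keys m \<subseteq> A}"
      moreover from this that have "Poly_Mapping.keys m \<subseteq> {..<n}" unfolding polys_in_def by blast
      ultimately show "Poly_Mapping.single m (Poly_Mapping.lookup h m) \<in> ?P"
        by (simp add: coord_prime_def)
    qed
  qed
  let ?f = "restrict_vars A f" and ?g = "restrict_vars A g"
  have fg': "f \<in> polys_in {..<n}" "g \<in> polys_in {..<n}" using fg by (simp_all add: carrier_poly_ring)
  have 1: "g * (f - ?f) \<in> ?P" by (rule mult[OF fg'(2) res(1)[OF fg'(1)]])
  have 2: "?f * (g - ?g) \<in> ?P" by (rule mult[OF res(2)[OF fg'(1)] res(1)[OF fg'(2)]])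
  have "?f * ?g = f * g + - (g * (f - ?f) + ?f * (g - ?g))" by (simp add: algebra_simps)
  also have "\<dots> \<in> ?P"
    using fg(3) by (intro add[OF _ minus[OF add[OF 1 2]]]) simp
  finally have "?f * ?g \<in> ?P" .
  moreover have "?f * ?g \<in> polys_in A" by (intro polys_in_mult restrict_vars_in)
  ultimately have "Poly_Mapping.keys (?f * ?g) = {}" unfolding coord_prime_def polys_in_def by blast
  then have "?f = 0 \<or> ?g = 0" by simp
  then show "f \<in> ?P \<or> g \<in> ?P" using res(1)[OF fg'(1)] res(1)[OF fg'(2)] by auto
qed

text \<open>
  A monomial is a product of variables, so a prime ideal containing it contains one of
  these; the induction splits off one variable at a time.
\<close>

lemma primeideal_contains_variable:
  assumes P: "primeideal P (poly_ring n :: ((nat \<Rightarrow>\<^sub>0 nat) \<Rightarrow>\<^sub>0 'k :: field) ring)"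
    and "Poly_Mapping.single m 1 \<in> P" "Poly_Mapping.keys m \<subseteq> {..<n}"
  shows "\<exists>i\<in>Poly_Mapping.keys m. Poly_Mapping.single (Poly_Mapping.single i 1) 1 \<in> P"
  using assms(2,3)
proof (induction "total_degree m" arbitrary: m rule: less_induct)
  case less
  show ?case
  proof (cases "m = 0")
    case True
    then show ?thesis using less.prems primeideal_unit[OF P, of 1] by simp
  next
    case False
    then obtain i where i: "i \<in> Poly_Mapping.keys m" by (auto simp flip: keys_eq_empty)
    define m' where "m' = m - Poly_Mapping.single i 1"
    have m: "m = Poly_Mapping.single i 1 + m'"
      using i by (intro poly_mapping_eqI) (auto simp: m'_def lookup_add lookup_minus lookup_single when_def in_keys_iff)
    have sub: "Poly_Mapping.keys m' \<subseteq> Poly_Mapping.keys m" by (auto simp: m keys_add_nat)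
    have "total_degree m' < total_degree m"
    proof -
      have "total_degree m' = (\<Sum>j\<in>Poly_Mapping.keys m. Poly_Mapping.lookup m' j)"
        unfolding total_degree_def using sub by (intro sum.mono_neutral_left) (auto simp: in_keys_iff)
      also have "\<dots> < total_degree m"
        unfolding total_degree_def
        using i by (intro sum_strict_mono_ex1) (auto simp: m'_def lookup_minus lookup_single when_def in_keys_iff)
      finally show ?thesis .
    qed
    moreover have "Poly_Mapping.single (Poly_Mapping.single i 1) (1::'k) * Poly_Mapping.single m' 1
        = Poly_Mapping.single m 1"
      by (simp only: mult_single m[symmetric] mult_1_right mult_1_left)
    moreover have "Poly_Mapping.single (Poly_Mapping.single i 1) (1::'k) \<in> polys_in {..<n}"
      "Poly_Mapping.single m' (1::'k) \<in> polys_in {..<n}"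
      using i sub less.prems(2) by (auto intro!: polys_in_single)
    ultimately consider "Poly_Mapping.single (Poly_Mapping.single i 1) 1 \<in> P"
      | "total_degree m' < total_degree m" "Poly_Mapping.single m' 1 \<in> P"
      using primeideal_prime[OF P] less.prems(1) by metis
    then show ?thesis
    proof cases
      case 1
      with i show ?thesis by blast
    next
      case 2
      with less.hyps[of m'] less.prems(2) sub show ?thesis by blast
    qed
  qed
qed

text \<open>
  Let \<open>A\<close> be the set of variables outside \<open>P 0\<close>. A monomial that involves another variable
  lies in \<open>P 0\<close>, so every polynomial agrees with its restriction to \<open>A\<close> modulo \<open>P 0\<close>, and
  the witnesses of the strict inclusions may be taken in \<open>polys_in A\<close>. More than \<open>card A\<close>
  of them would be algebraically dependent, contradicting \<open>no_relation_along_chain\<close>.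
\<close>

lemma primeideal_chain_length:
  fixes P :: "nat \<Rightarrow> ((nat \<Rightarrow>\<^sub>0 nat) \<Rightarrow>\<^sub>0 'k :: field) set"
  assumes P: "\<And>i. i \<le> l \<Longrightarrow> primeideal (P i) (poly_ring n)"
    and chain: "\<And>i. i < l \<Longrightarrow> P i \<subset> P (Suc i)"
  shows "l \<le> card {i. i < n \<and> Poly_Mapping.single (Poly_Mapping.single i 1) 1 \<notin> P 0}"
proof (rule ccontr)
  define A where "A = {i. i < n \<and> Poly_Mapping.single (Poly_Mapping.single i 1) (1::'k) \<notin> P 0}"
  assume "\<not> ?thesis"
  then have "card A < l" by (simp add: A_def)
  have P0: "primeideal (P 0) (poly_ring n)" using P by simp
  have "\<exists>y \<in> polys_in A. y \<in> P (Suc i) - P i" if i: "i < l" for i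
  proof -
    obtain z where z: "z \<in> P (Suc i)" "z \<notin> P i" using chain[OF i] by blast
    have zS: "z \<in> polys_in {..<n}" using primeideal_subset[OF P, of "Suc i"] z i by auto
    have "z - restrict_vars A z \<in> P 0"
      unfolding diff_restrict_vars
    proof (rule primeideal_sum[OF P0])
      fix m assume "m \<in> {m. m \<in> Poly_Mapping.keys z \<and> \<not> Poly_Mapping.keys m \<subseteq> A}"
      then obtain j where j: "m \<in> Poly_Mapping.keys z" "j \<in> Poly_Mapping.keys m" "j \<notin> A" by blast
      have mn: "Poly_Mapping.keys m \<subseteq> {..<n}" using j zS by (auto simp: polys_in_def)
      then have X: "Poly_Mapping.single (Poly_Mapping.single j 1) 1 \<in> P 0"
        using j by (auto simp: A_def)
      define m' where "m' = m - Poly_Mapping.single j 1"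
      have m: "m = m' + Poly_Mapping.single j 1"
        using j by (intro poly_mapping_eqI) (auto simp: m'_def lookup_add lookup_minus lookup_single when_def in_keys_iff)
      have "Poly_Mapping.single m' (Poly_Mapping.lookup z m) * Poly_Mapping.single (Poly_Mapping.single j 1) 1 \<in> P 0"
        using mn by (intro primeideal_mult[OF P0 _ X] polys_in_single) (auto simp: m keys_add_nat)
      then show "Poly_Mapping.single m (Poly_Mapping.lookup z m) \<in> P 0"
        by (simp only: mult_single m[symmetric] mult_1_right mult_1_left)
    qed
    moreover have mono: "P 0 \<subseteq> P j" if "j \<le> l" for j
      using that
    proof (induction j)
      case (Suc j)
      then show ?case using chain[of j] by auto
    qed simp
    ultimately have d: "z - restrict_vars A z \<in> P i" "z - restrict_vars A z \<in> P (Suc i)"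
      using i by (meson less_imp_le Suc_leI subsetD)+
    have "restrict_vars A z \<in> P (Suc i)"
      using primeideal_diff[OF P[of "Suc i"] z(1) d(2)] i by simp
    moreover have "restrict_vars A z \<notin> P i"
      using primeideal_add[OF P[of i] d(1), of "restrict_vars A z"] i z by auto
    ultimately show ?thesis using restrict_vars_in by blast
  qed
  then obtain y where y: "\<And>i. i < l \<Longrightarrow> y i \<in> polys_in A \<and> y i \<in> P (Suc i) - P i" by metis
  define ys where "ys = map y [0..<l]"
  have "finite A" by (simp add: A_def)
  moreover have "set ys \<subseteq> polys_in A" using y by (auto simp: ys_def)
  moreover have "card A < length ys" using \<open>card A < l\<close> by (simp add: ys_def)
  ultimately obtain E c where E: "finite E" "E \<noteq> {}" "\<And>e. e \<in> E \<Longrightarrow> length e = length ys \<and> c e \<noteq> 0"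
    "(\<Sum>e\<in>E. Poly_Mapping.single 0 (c e) * power_product ys e) = 0"
    by (rule algebraically_dependent) (rule that)
  have "(\<Sum>e\<in>E. Poly_Mapping.single 0 (c e) * power_product ys e) \<notin> P 0"
    using P chain y E(1-3) by (intro no_relation_along_chain[of ys P n]) (auto simp: ys_def)
  then show False using E(4) primeideal_zero[OF P0] by simp
qed

section \<open>The dimension of a monomial quotient\<close>

text \<open>
  This lemma and the next are the two directions of the correspondence between the prime
  ideals of \<open>R Quot I\<close> and those of \<open>R\<close> that contain \<open>I\<close>. An ideal of the quotient is
  a set of cosets, and its preimage is their union.
\<close>

lemma (in cring) primeideal_quot_vimage:
  assumes "ideal I R" "primeideal J (R Quot I)"
  shows "primeideal (\<Union> J) R" "I \<subseteq> \<Union> J"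
proof -
  interpret J: primeideal J "R Quot I" by fact
  interpret I: ideal I R by fact
  have "\<zero>\<^bsub>R Quot I\<^esub> \<in> J" by (rule additive_subgroup.zero_closed[OF J.is_additive_subgroup])
  then have "I \<in> J" by (simp add: FactRing_def)
  then show "I \<subseteq> \<Union> J" by blast
  have iff: "a \<in> \<Union> J \<longleftrightarrow> I +> a \<in> J" if "a \<in> carrier R" for a
    by (rule canonical_proj_vimage_mem_iff[OF assms(1) J.a_subset that])
  have carr: "I +> a \<in> carrier (R Quot I)" if "a \<in> carrier R" for a
    using ring_hom_closed[OF I.rcos_ring_hom that] .
  have one: "I +> \<one> = \<one>\<^bsub>R Quot I\<^esub>"
    using ring_hom_one[OF I.rcos_ring_hom] .
  show "primeideal (\<Union> J) R"
  proof (rule primeidealI)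
    show "ideal (\<Union> J) R" by (rule quot_ideal_imp_ring_ideal[OF assms(1) J.ideal_axioms])
    show "cring R" by (rule is_cring)
    show "carrier R \<noteq> \<Union> J"
      using iff[OF one_closed] one J.one_imp_carrier J.I_notcarr one_closed by auto
    fix a b assume "a \<in> carrier R" "b \<in> carrier R" "a \<otimes> b \<in> \<Union> J"
    then show "a \<in> \<Union> J \<or> b \<in> \<Union> J"
      using iff J.I_prime[OF carr carr, of a b] ring_hom_mult[OF I.rcos_ring_hom, of a b] by simp
  qed
qed

lemma (in cring) primeideal_quot_image:
  assumes "ideal I R" "primeideal P R" "I \<subseteq> P"
  shows "primeideal ((+>) I ` P) (R Quot I)"
proof (rule primeidealI)
  interpret P: primeideal P R by fact
  interpret I: ideal I R by fact
  have UN: "\<Union> ((+>) I ` P) = P"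
    using ideal_incl_iff[OF assms(1) P.ideal_axioms] assms(3) by simp
  show id: "ideal ((+>) I ` P) (R Quot I)"
    by (rule ring_ideal_imp_quot_ideal[OF assms(1) P.ideal_axioms])
  interpret J: ideal "(+>) I ` P" "R Quot I" by fact
  show "cring (R Quot I)" by (rule I.quotient_is_cring[OF is_cring])
  have iff: "a \<in> P \<longleftrightarrow> I +> a \<in> (+>) I ` P" if "a \<in> carrier R" for a
    using canonical_proj_vimage_mem_iff[OF assms(1) J.a_subset that] UN by simp
  show "carrier (R Quot I) \<noteq> (+>) I ` P"
    using iff ring_hom_closed[OF I.rcos_ring_hom] P.I_notcarr P.a_subset by blast
  fix X Y assume XY: "X \<in> carrier (R Quot I)" "Y \<in> carrier (R Quot I)" "X \<otimes>\<^bsub>R Quot I\<^esub> Y \<in> (+>) I ` P"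
  then obtain a b where ab: "a \<in> carrier R" "b \<in> carrier R" "X = I +> a" "Y = I +> b"
    unfolding FactRing_def using A_RCOSETS_def'[of R I] by auto
  then show "X \<in> (+>) I ` P \<or> Y \<in> (+>) I ` P"
    using XY(3) iff P.I_prime[of a b] ring_hom_mult[OF I.rcos_ring_hom, of a b] by auto
qed

text \<open>
  The zero set of a monomial ideal is a union of coordinate subspaces, and its dimension
  is the largest size of a set \<open>A\<close> of variables such that no generator is a monomial in
  the variables \<open>A\<close> alone. For \<open>\<ge>\<close>, dropping the elements of \<open>A\<close> one by one gives
  \<open>t + 1\<close> coordinate subspaces in the zero set, whose primes form a chain. For \<open>\<le>\<close>,
  a prime containing the ideal contains a variable of each generator, hence a variable of
  each set of size \<open>t + 1\<close>; so it misses at most \<open>t\<close> variables, which bounds every chain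
  above it.
\<close>

lemma krull_dim_monomial_quotient:
  assumes B: "B \<subseteq> {m. Poly_Mapping.keys m \<subseteq> {..<n}}"
    and A: "A \<subseteq> {..<n}" "card A = t" "\<And>m. m \<in> B \<Longrightarrow> \<not> Poly_Mapping.keys m \<subseteq> A"
    and hit: "\<And>A. A \<subseteq> {..<n} \<Longrightarrow> card A = t + 1 \<Longrightarrow> \<exists>m\<in>B. Poly_Mapping.keys m \<subseteq> A"
  shows "krull_dim (poly_ring n Quot
      (monomial_ideal n B :: ((nat \<Rightarrow>\<^sub>0 nat) \<Rightarrow>\<^sub>0 'k :: field) set)) = ereal (real t)"
proof -
  define I where "I = (monomial_ideal n B :: ((nat \<Rightarrow>\<^sub>0 nat) \<Rightarrow>\<^sub>0 'k) set)"
  let ?R = "poly_ring n :: ((nat \<Rightarrow>\<^sub>0 nat) \<Rightarrow>\<^sub>0 'k) ring"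
  interpret cring ?R by (rule cring_poly_ring)
  let ?gens = "(\<lambda>m. Poly_Mapping.single m 1) ` B :: ((nat \<Rightarrow>\<^sub>0 nat) \<Rightarrow>\<^sub>0 'k) set"
  have gens: "?gens \<subseteq> carrier ?R"
    using B by (auto simp: carrier_poly_ring intro!: polys_in_single)
  have idI: "ideal I ?R" and gI: "?gens \<subseteq> I"
    unfolding I_def monomial_ideal_def by (rule genideal_ideal[OF gens], rule genideal_self[OF gens])
  let ?L = "{ereal (real l) | l. \<exists>P. (\<forall>i\<le>l. primeideal (P i) (?R Quot I)) \<and> (\<forall>i<l. P i \<subset> P (Suc i))}"
  have "x \<le> ereal (real t)" if "x \<in> ?L" for x
  proof -
    from that obtain l P where x: "x = ereal (real l)"
      and P: "\<And>i. i \<le> l \<Longrightarrow> primeideal (P i) (?R Quot I)"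
      and chain: "\<And>i. i < l \<Longrightarrow> P i \<subset> P (Suc i)" by blast
    define Q where "Q i = \<Union> (P i)" for i
    have Q: "primeideal (Q i) ?R" "I \<subseteq> Q i" if "i \<le> l" for i
      unfolding Q_def using primeideal_quot_vimage[OF idI P[OF that]] by auto
    have PQ: "P i = (+>\<^bsub>?R\<^esub>) I ` Q i" if "i \<le> l" for i
    proof -
      have id: "ideal (P i) (?R Quot I)" using P[OF that] by (simp add: primeideal_def)
      have sub: "P i \<subseteq> carrier (?R Quot I)"
        using additive_subgroup.a_subset id unfolding ideal_def by blast
      show ?thesis
      proof
        show "P i \<subseteq> (+>\<^bsub>?R\<^esub>) I ` Q i"
        proof
          fix X assume X: "X \<in> P i"
          then obtain a where a: "a \<in> carrier ?R" "X = I +>\<^bsub>?R\<^esub> a"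
            using sub unfolding FactRing_def A_RCOSETS_def'[of ?R I] by auto
          then show "X \<in> (+>\<^bsub>?R\<^esub>) I ` Q i"
            using canonical_proj_vimage_mem_iff[OF idI sub a(1)] X by (auto simp: Q_def)
        qed
        show "(+>\<^bsub>?R\<^esub>) I ` Q i \<subseteq> P i"
          using canonical_proj_vimage_mem_iff[OF idI sub] canonical_proj_vimage_in_carrier[OF idI sub]
          by (auto simp: Q_def)
      qed
    qed
    have "Q i \<subset> Q (Suc i)" if "i < l" for i
    proof -
      have "Q i \<subseteq> Q (Suc i)" using chain[OF that] by (auto simp: Q_def)
      moreover have "Q i \<noteq> Q (Suc i)" using chain[OF that] PQ[of i] PQ[of "Suc i"] that by auto
      ultimately show ?thesis by blast
    qed
    define A' where "A' = {i. i < n \<and> Poly_Mapping.single (Poly_Mapping.single i 1) 1 \<notin> Q 0}"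
    have "l \<le> card A'"
      unfolding A'_def by (rule primeideal_chain_length) fact+
    moreover have "card A' \<le> t"
    proof (rule ccontr)
      assume "\<not> card A' \<le> t"
      then obtain T where T: "T \<subseteq> A'" "card T = t + 1"
        by (metis obtain_subset_with_card_n Suc_eq_plus1 not_less_eq_eq)
      then have "T \<subseteq> {..<n}" by (auto simp: A'_def)
      then obtain m where m: "m \<in> B" "Poly_Mapping.keys m \<subseteq> T" using hit T by blast
      then have "Poly_Mapping.single m 1 \<in> Q 0" using gI Q(2)[of 0] by auto
      then obtain i where "i \<in> Poly_Mapping.keys m" "Poly_Mapping.single (Poly_Mapping.single i 1) 1 \<in> Q 0"
        using primeideal_contains_variable[OF Q(1)[of 0]] m B by blast
      then show False using m T by (auto simp: A'_def)
    qed
    ultimately show ?thesis by (simp add: x)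
  qed
  moreover have "ereal (real t) \<in> ?L"
  proof -
    \<comment> \<open>\<open>f\<close> enumerates \<open>A\<close>; the ideal \<open>C i\<close> kills all variables except \<open>f i, \<dots>, f (t - 1)\<close>\<close>
    obtain f where f: "bij_betw f {..<t} A"
      using A(1,2) by (metis atLeast0LessThan ex_bij_betw_nat_finite finite_lessThan finite_subset)
    define C where "C i = (coord_prime n (f ` {i..<t}) :: ((nat \<Rightarrow>\<^sub>0 nat) \<Rightarrow>\<^sub>0 'k) set)" for i
    have fA: "f ` {i..<t} \<subseteq> A" for i using f by (auto simp: bij_betw_def)
    have prime: "primeideal (C i) ?R" for i unfolding C_def by (rule primeideal_coord_prime)
    have IC: "I \<subseteq> C i" for i
      unfolding I_def monomial_ideal_def
    proof (rule genideal_minimal)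
      show "ideal (C i) ?R" using prime by (simp add: primeideal_def)
      show "?gens \<subseteq> C i" using A(3) fA B unfolding C_def coord_prime_def
        by (fastforce intro!: polys_in_single)
    qed
    have sub: "C i \<subset> C (Suc i)" if "i < t" for i
    proof -
      have "C i \<subseteq> C (Suc i)"
        unfolding C_def coord_prime_def
        using image_mono[of "{Suc i..<t}" "{i..<t}" f] by force
      moreover have "Poly_Mapping.single (Poly_Mapping.single (f i) 1) 1 \<in> C (Suc i) - C i"
      proof -
        have "f i \<in> {..<n}" using f A(1) that by (auto simp: bij_betw_def)
        moreover have "f i \<notin> f ` {Suc i..<t}"
          using f that inj_on_contraD[of f "{..<t}" i] by (force simp: bij_betw_def)
        ultimately show ?thesis using that by (auto simp: C_def coord_prime_def intro!: polys_in_single)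
      qed
      ultimately show ?thesis by blast
    qed
    have "(+>\<^bsub>?R\<^esub>) I ` C i \<subset> (+>\<^bsub>?R\<^esub>) I ` C (Suc i)" if "i < t" for i
    proof -
      have "\<Union> ((+>\<^bsub>?R\<^esub>) I ` C j) = C j" for j
        using ideal_incl_iff[OF idI, of "C j"] IC[of j] prime[of j] by (simp add: primeideal_def)
      then show ?thesis using sub[OF that] by (metis image_mono psubset_eq)
    qed
    then show ?thesis
      using primeideal_quot_image[OF idI prime IC]
      by (intro CollectI exI[of _ t] conjI exI[of _ "\<lambda>i. (+>\<^bsub>?R\<^esub>) I ` C i"]) auto
  qed
  ultimately show ?thesis
    unfolding krull_dim_def I_def[symmetric] by (intro antisym Sup_least Sup_upper)
qed


section \<open>Probability estimates\<close>

lemma prob_no_member_of: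
  assumes "0 \<le> q" "q \<le> 1" "M \<subseteq> monomials n D"
  shows "measure_pmf.prob (random_monomials n D q) {B. B \<inter> M = {}} = (1 - q) ^ card M"
proof -
  have "measure_pmf.prob (random_monomials n D q) {B. B \<inter> M = {}}
      = measure_pmf.prob (Pi_pmf (monomials n D) False (\<lambda>_. bernoulli_pmf q))
          (Pi (monomials n D) (\<lambda>m. if m \<in> M then {False} else UNIV))"
    unfolding random_monomials_def measure_map_pmf
    using assms(3) by (intro arg_cong2[where f = measure_pmf.prob] refl) (auto simp: Pi_def split: if_splits)
  also have "\<dots> = (\<Prod>m\<in>monomials n D. if m \<in> M then 1 - q else 1)"
    unfolding measure_Pi_pmf_Pi[OF finite_monomials]
    using assms by (intro prod.cong) (auto simp: measure_pmf_single)
  also have "\<dots> = (1 - q) ^ card M"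
    using assms(3) finite_monomials[of n D]
    by (simp add: prod.If_cases Int_absorb1)
  finally show ?thesis .
qed

lemma monomials_supported_subset_box:
  "{m \<in> monomials n D. Poly_Mapping.keys m \<subseteq> A} \<subseteq> box A D"
proof safe
  fix m assume m: "m \<in> monomials n D" "Poly_Mapping.keys m \<subseteq> A"
  have "Poly_Mapping.lookup m i \<le> D" for i
  proof (cases "i \<in> Poly_Mapping.keys m")
    case True
    then have "Poly_Mapping.lookup m i \<le> total_degree m"
      unfolding total_degree_def by (intro member_le_sum) auto
    with m show ?thesis by (simp add: monomials_def)
  qed (simp add: in_keys_iff)
  with m show "m \<in> box A D" by (simp add: box_def)
qed

text \<open>
  Exponents of at most \<open>D div card A\<close> in each of \<open>card A\<close> variables keep the total degree
  at most \<open>D\<close>; so a constant proportion of all exponents up to \<open>D\<close> is admissible.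
\<close>

lemma box_subset_monomials:
  assumes "A \<subseteq> {..<n}"
  shows "box A (D div card A) - {0} \<subseteq> {m \<in> monomials n D. Poly_Mapping.keys m \<subseteq> A}"
proof safe
  fix m assume m: "m \<in> box A (D div card A)" "m \<noteq> 0"
  show A: "i \<in> A" if "i \<in> Poly_Mapping.keys m" for i using m that by (auto simp: box_def)
  have "total_degree m \<le> card (Poly_Mapping.keys m) * (D div card A)"
    unfolding total_degree_def using m by (intro sum_bounded_above[of _ _ "_ :: nat", simplified]) (auto simp: box_def)
  also have "\<dots> \<le> card A * (D div card A)"
    using A finite_subset[OF assms] by (intro mult_le_mono1 card_mono) auto
  also have "\<dots> \<le> D" by simp
  finally show "m \<in> monomials n D"
    using m(2) A assms by (auto simp: monomials_def)
qed

text \<open>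
  Union bound over the ways in which the hypotheses of
  \<open>krull_dim_monomial_quotient\<close> can fail. The first summand bounds the probability that a
  monomial in the first \<open>t\<close> variables is chosen: there are at most \<open>(D + 1) ^ t\<close> of them.
  The second bounds, for each of the \<open>n choose (t + 1)\<close> sets of \<open>t + 1\<close> variables, the
  probability that no monomial in these variables is chosen. There are at least
  \<open>(D / (t + 1)) ^ (t + 1) - 1\<close> such monomials, because the constant one is excluded, and
  \<open>q \<le> 1\<close> turns this \<open>1\<close> into the summand \<open>1\<close> of the exponent.
\<close>

lemma prob_krull_dim_neq_le:
  fixes q :: real
  assumes q: "0 \<le> q" "q \<le> 1" and t: "t < n"
  shows "1 - measure_pmf.prob
            (random_monomial_ideal n D q :: ((nat \<Rightarrow>\<^sub>0 nat) \<Rightarrow>\<^sub>0 'k :: field) set pmf)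
            {I. krull_dim (poly_ring n Quot I) = ereal (real t)}
         \<le> q * (real D + 1) ^ t + real (n choose (t + 1)) * exp (1 - q * (real D / (real t + 1)) ^ (t + 1))"
proof -
  let ?P = "random_monomials n D q"
  let ?M = "\<lambda>A. {m \<in> monomials n D. Poly_Mapping.keys m \<subseteq> A}"
  let ?S = "{I :: ((nat \<Rightarrow>\<^sub>0 nat) \<Rightarrow>\<^sub>0 'k) set. krull_dim (poly_ring n Quot I) = ereal (real t)}"
  define T where "T = {A. A \<subseteq> {..<n} \<and> card A = t + 1}"
  have T: "finite T" "card T = n choose (t + 1)"
    unfolding T_def by (auto simp: n_subsets)
  \<comment> \<open>holds only almost surely, hence the intersection with \<^const>\<open>set_pmf\<close> below\<close>
  have supp: "B \<subseteq> monomials n D" if "B \<in> set_pmf ?P" for B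
    using that set_Pi_pmf_subset[OF finite_monomials, of n D False "\<lambda>_. bernoulli_pmf q"]
    by (auto simp: random_monomials_def)
  have "1 - measure_pmf.prob (random_monomial_ideal n D q) ?S
      = measure_pmf.prob ?P (- (monomial_ideal n -` ?S))"
    by (simp add: random_monomial_ideal_def measure_map_pmf measure_pmf.prob_compl[of _ ?P, simplified] Compl_eq_Diff_UNIV)
  also have "\<dots> = measure_pmf.prob ?P (- (monomial_ideal n -` ?S) \<inter> set_pmf ?P)"
    by (simp add: measure_Int_set_pmf)
  also have "\<dots> \<le> measure_pmf.prob ?P (- {B. B \<inter> ?M {..<t} = {}} \<union> (\<Union>A\<in>T. {B. B \<inter> ?M A = {}}))"
  proof (rule measure_pmf.finite_measure_mono)
    show "- (monomial_ideal n -` ?S) \<inter> set_pmf ?P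
        \<subseteq> - {B. B \<inter> ?M {..<t} = {}} \<union> (\<Union>A\<in>T. {B. B \<inter> ?M A = {}})"
    proof (rule subsetI, rule ccontr)
      fix B assume B: "B \<in> - (monomial_ideal n -` ?S) \<inter> set_pmf ?P"
        and no: "B \<notin> - {B. B \<inter> ?M {..<t} = {}} \<union> (\<Union>A\<in>T. {B. B \<inter> ?M A = {}})"
      have BD: "B \<subseteq> monomials n D" using B supp by blast
      have "krull_dim (poly_ring n Quot (monomial_ideal n B :: ((nat \<Rightarrow>\<^sub>0 nat) \<Rightarrow>\<^sub>0 'k) set)) = ereal (real t)"
      proof (rule krull_dim_monomial_quotient)
        show "B \<subseteq> {m. Poly_Mapping.keys m \<subseteq> {..<n}}" using BD by (auto simp: monomials_def)
        show "{..<t} \<subseteq> {..<n}" "card {..<t} = t" using t by auto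
        show "\<not> Poly_Mapping.keys m \<subseteq> {..<t}" if "m \<in> B" for m using no BD that by blast
        show "\<exists>m\<in>B. Poly_Mapping.keys m \<subseteq> A" if "A \<subseteq> {..<n}" "card A = t + 1" for A
        proof -
          have "A \<in> T" using that by (simp add: T_def)
          then show ?thesis using no by blast
        qed
      qed
      then show False using B by simp
    qed
  qed simp
  also have "\<dots> \<le> measure_pmf.prob ?P (- {B. B \<inter> ?M {..<t} = {}})
      + measure_pmf.prob ?P (\<Union>A\<in>T. {B. B \<inter> ?M A = {}})"
    by (rule measure_Un_le) auto
  also have "measure_pmf.prob ?P (\<Union>A\<in>T. {B. B \<inter> ?M A = {}})
      \<le> (\<Sum>A\<in>T. measure_pmf.prob ?P {B. B \<inter> ?M A = {}})"
    using T(1) by (intro measure_pmf.finite_measure_subadditive_finite) auto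
  also have "\<dots> \<le> (\<Sum>A\<in>T. exp (1 - q * (real D / (real t + 1)) ^ (t + 1)))"
  proof (rule sum_mono)
    fix A assume "A \<in> T"
    then have A: "A \<subseteq> {..<n}" "card A = t + 1" "finite A"
      by (auto simp: T_def intro: finite_subset)
    let ?d = "D div (t + 1)"
    have "card (box A ?d - {0}) \<le> card (?M A)"
      using box_subset_monomials[OF A(1), of D] finite_monomials[of n D] A(2) by (intro card_mono) auto
    moreover have "card (box A ?d - {0}) = (?d + 1) ^ (t + 1) - 1"
    proof -
      have "0 \<in> box A ?d" by (simp add: box_def)
      from card_Diff_singleton[OF this] show ?thesis by (simp only: card_box[OF A(3)] A(2))
    qed
    ultimately have "(?d + 1) ^ (t + 1) \<le> card (?M A) + 1"
      by (simp only: le_diff_conv)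
    then have "real ((?d + 1) ^ (t + 1)) \<le> real (card (?M A) + 1)"
      by (rule of_nat_mono)
    then have "(real ?d + 1) ^ (t + 1) \<le> real (card (?M A)) + 1"
      by (simp only: of_nat_power of_nat_add of_nat_1)
    moreover have "real D / (real t + 1) \<le> real ?d + 1"
    proof -
      have "D \<le> (?d + 1) * (t + 1)"
        using dividend_less_div_times[of "t + 1" D] by (simp add: algebra_simps)
      then have "real D \<le> real ((?d + 1) * (t + 1))" by (rule of_nat_mono)
      then have "real D \<le> (real ?d + 1) * (real t + 1)"
        by (simp only: of_nat_mult of_nat_add of_nat_1)
      then show ?thesis by (simp add: pos_divide_le_eq)
    qed
    then have "(real D / (real t + 1)) ^ (t + 1) \<le> (real ?d + 1) ^ (t + 1)"
      by (intro power_mono) auto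
    ultimately have "(real D / (real t + 1)) ^ (t + 1) \<le> real (card (?M A)) + 1" by linarith
    then have "q * (real D / (real t + 1)) ^ (t + 1) \<le> q * (real (card (?M A)) + 1)"
      using q by (intro mult_left_mono)
    then have card: "q * (real D / (real t + 1)) ^ (t + 1) \<le> q * real (card (?M A)) + 1"
      using q by (simp add: distrib_left)
    have "measure_pmf.prob ?P {B. B \<inter> ?M A = {}} = (1 - q) ^ card (?M A)"
      using q by (intro prob_no_member_of) auto
    also have "\<dots> \<le> exp (- q) ^ card (?M A)"
      using q exp_ge_add_one_self[of "- q"] by (intro power_mono) auto
    also have "\<dots> = exp (- (q * real (card (?M A))))"
      by (simp flip: exp_of_nat_mult add: mult.commute)
    also have "\<dots> \<le> exp (1 - q * (real D / (real t + 1)) ^ (t + 1))"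
      using card by simp
    finally show "measure_pmf.prob ?P {B. B \<inter> ?M A = {}} \<le> \<dots>" .
  qed
  also have "\<dots> = real (n choose (t + 1)) * exp (1 - q * (real D / (real t + 1)) ^ (t + 1))"
    by (simp add: T)
  also have "measure_pmf.prob ?P (- {B. B \<inter> ?M {..<t} = {}}) \<le> q * (real D + 1) ^ t"
  proof -
    have "measure_pmf.prob ?P (- {B. B \<inter> ?M {..<t} = {}}) = 1 - (1 - q) ^ card (?M {..<t})"
      using prob_no_member_of[OF q, of "?M {..<t}" n D]
      by (simp add: Compl_eq_Diff_UNIV measure_pmf.prob_compl[of _ ?P, simplified])
    also have "\<dots> \<le> real (card (?M {..<t})) * q"
      using Bernoulli_inequality[of "- q" "card (?M {..<t})"] q by simp
    also have "\<dots> \<le> (real D + 1) ^ t * q"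
    proof (rule mult_right_mono[OF _ q(1)])
      have "card (?M {..<t}) \<le> card (box {..<t} D)"
        by (intro card_mono finite_box monomials_supported_subset_box) simp
      also have "\<dots> = (D + 1) ^ t" by (simp add: card_box)
      finally have "real (card (?M {..<t})) \<le> real ((D + 1) ^ t)" by (rule of_nat_mono)
      then show "real (card (?M {..<t})) \<le> (real D + 1) ^ t"
        by (simp only: of_nat_power of_nat_add of_nat_1)
    qed
    finally show ?thesis by (simp only: mult.commute)
  qed
  finally show ?thesis by simp
qed

section \<open>The threshold for the dimension\<close>

theorem corollary1p2:
  fixes n t :: nat and p :: "nat \<Rightarrow> real"
  assumes "n \<ge> 1" and "t < n"
    and "\<And>D. 0 \<le> p D \<and> p D \<le> 1"
    and "p \<in> \<omega>(\<lambda>D. real D powi (- (int t + 1)))"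
    and "p \<in> o(\<lambda>D. real D powi (- int t))"
  shows "(\<lambda>D. measure_pmf.prob
            (random_monomial_ideal n D (p D) :: ((nat \<Rightarrow>\<^sub>0 nat) \<Rightarrow>\<^sub>0 'k :: field) set pmf)
            {I. krull_dim (poly_ring n Quot I) = ereal (real t)}) \<longlonglongrightarrow> 1"
proof -
  let ?X = "\<lambda>D. measure_pmf.prob
            (random_monomial_ideal n D (p D) :: ((nat \<Rightarrow>\<^sub>0 nat) \<Rightarrow>\<^sub>0 'k :: field) set pmf)
            {I. krull_dim (poly_ring n Quot I) = ereal (real t)}"
  define b1 where "b1 D = p D * (real D + 1) ^ t" for D
  define b2 where "b2 D = real (n choose (t + 1)) * exp (1 - p D * (real D / (real t + 1)) ^ (t + 1))" for D
  have "(\<lambda>D. p D / real D powi (- int t)) \<longlonglongrightarrow> 0"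
    using smalloD_tendsto[OF assms(5)] .
  then have "(\<lambda>D. 2 ^ t * (p D * real D ^ t)) \<longlonglongrightarrow> 0"
    by (intro tendsto_mult_right_zero) (simp add: power_int_minus divide_inverse)
  then have b1: "b1 \<longlonglongrightarrow> 0"
  proof (rule tendsto_sandwich[OF _ _ tendsto_const, rotated 2])
    show "eventually (\<lambda>D. 0 \<le> b1 D) sequentially" using assms(3) by (simp add: b1_def)
    show "eventually (\<lambda>D. b1 D \<le> 2 ^ t * (p D * real D ^ t)) sequentially"
      using eventually_ge_at_top[of 1]
    proof eventually_elim
      case (elim D)
      then have "(real D + 1) ^ t \<le> (2 * real D) ^ t" by (intro power_mono) auto
      then show ?case
        using mult_left_mono[of "(real D + 1) ^ t" "(2 * real D) ^ t" "p D"] assms(3)[of D]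
        by (simp add: b1_def power_mult_distrib mult_ac)
    qed
  qed
  have "filterlim (\<lambda>D. norm (p D / real D powi (- (int t + 1)))) at_top sequentially"
    by (rule smallomegaD_filterlim_at_top_norm[OF assms(4)])
      (auto intro: eventually_mono[OF eventually_gt_at_top[of 0]])
  also have "(\<lambda>D. norm (p D / real D powi (- (int t + 1)))) = (\<lambda>D. p D * real D ^ (t + 1))"
  proof
    fix D
    have "real D powi (- (int t + 1)) = inverse (real D ^ (t + 1))"
    proof -
      have "- (int t + 1) = - int (t + 1)" by simp
      then show ?thesis by (simp only: power_int_minus power_int_of_nat)
    qed
    then show "norm (p D / real D powi (- (int t + 1))) = p D * real D ^ (t + 1)"
      using assms(3) by (simp add: divide_inverse abs_mult)
  qed
  finally have "filterlim (\<lambda>D. (1 / (real t + 1)) ^ (t + 1) * (p D * real D ^ (t + 1))) at_top sequentially"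
    by (intro filterlim_tendsto_pos_mult_at_top[OF tendsto_const]) auto
  then have "filterlim (\<lambda>D. - 1 + p D * (real D / (real t + 1)) ^ (t + 1)) at_top sequentially"
    by (intro filterlim_tendsto_add_at_top[OF tendsto_const]) (simp add: power_divide mult_ac)
  then have "filterlim (\<lambda>D. 1 - p D * (real D / (real t + 1)) ^ (t + 1)) at_bot sequentially"
    unfolding filterlim_uminus_at_top by simp
  then have b2: "b2 \<longlonglongrightarrow> 0"
    unfolding b2_def by (intro tendsto_mult_right_zero filterlim_compose[OF exp_at_bot])
  have "(\<lambda>D. 1 - (b1 D + b2 D)) \<longlonglongrightarrow> 1 - (0 + 0)"
    by (intro tendsto_intros b1 b2)
  then have lower: "(\<lambda>D. 1 - (b1 D + b2 D)) \<longlonglongrightarrow> 1" by simp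
  show ?thesis
  proof (rule tendsto_sandwich[OF _ _ lower tendsto_const])
    show "eventually (\<lambda>D. 1 - (b1 D + b2 D) \<le> ?X D) sequentially"
    proof (rule always_eventually, rule allI)
      fix D
      show "1 - (b1 D + b2 D) \<le> ?X D"
        using prob_krull_dim_neq_le[of "p D" t n D, where 'k = 'k] assms(2,3)
        by (simp add: b1_def b2_def algebra_simps)
    qed
  qed simp
qed

end
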